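(* Let $n\ge 2$ be an integer and let $0\le a_1\le a_2\le\cdots\le a_n\le 1$ be real numbers. Let $p$ be the largest integer in $\{0,1,\dots,\lfloor (n-1)/2\rfloor\}$ such that $a_{2i}+a_{2i+1}\le 1$ for all $1\le i\le p$, and let $m$ be the largest integer in $\{0,1,\dots,\lfloor n/2\rfloor\}$ such that $a_{2i-1}+a_{2i}\le 1$ for all $1\le i\le m$. Then every probability measure $P$ on $(\Omega,\Sigma)$ with $P(A_j)=a_j$ for all $j\in[n]$ and with respect to which $A_1,\dots,A_n$ are $(n-1)$-wise independent has the form $$P(\mathbf{A}^J)=\mathbf{a}^J+(-1)^{|J|}s\quad\text{for all } J\subseteq[n],$$ where $s$ is a real parameter satisfying $$-\prod_{i=1}^{2m}a_i\prod_{i=2m+1}^{n}(1-a_i)\;\le\; s\;\le\;\prod_{i=1}^{2p+1}a_i\prod_{i=2p+2}^{n}(1-a_i).$$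
   Context: Here $[n]=\{1,\dots,n\}$ and $\Omega=\{\omega_J: J\subseteq[n]\}$ is a set with $2^n$ elements, the sample space freely generated by $n$ events $A_1,\dots,A_n\subseteq\Omega$; that is, $A_j=\{\omega_J: j\in J\}$, so that $\{\omega_J\}=\mathbf{A}^J:=\bigcap_{j\in J}A_j\cap\bigcap_{j\notin J}\overline{A}_j$ for every $J\subseteq[n]$. $\Sigma$ is the $\sigma$-algebra of all subsets of $\Omega$. For $J\subseteq[n]$ put $\mathbf{a}^J:=\prod_{j\in J}a_j\prod_{j\in[n]\setminus J}(1-a_j)$. The events $A_1,\dots,A_n$ are $(n-1)$-wise independent with respect to $P$ if any $n-1$ of them are mutually independent, i.e. $P(\bigcap_{j\in J}A_j)=\prod_{j\in J}P(A_j)$ for every $J\subseteq[n]$ with $|J|\le n-1$. Empty products equal $1$. *)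

theory Defs
  imports "HOL-Probability.Probability"
begin

definition sample_space :: "(nat set \<Rightarrow> 'a) \<Rightarrow> nat \<Rightarrow> 'a set" where
  "sample_space \<omega> n = \<omega> ` Pow {1..n}"

definition gen_event :: "(nat set \<Rightarrow> 'a) \<Rightarrow> nat \<Rightarrow> nat \<Rightarrow> 'a set" where
  "gen_event \<omega> n j = \<omega> ` {J. J \<subseteq> {1..n} \<and> j \<in> J}"

(* The leading intersection with \<Omega> fixes the convention that the empty intersection is \<Omega>. *)
definition atom_event :: "'a set \<Rightarrow> (nat \<Rightarrow> 'a set) \<Rightarrow> nat \<Rightarrow> nat set \<Rightarrow> 'a set" where
  "atom_event \<Omega> A n J = \<Omega> \<inter> (\<Inter>j\<in>J. A j) \<inter> (\<Inter>j\<in>{1..n} - J. \<Omega> - A j)"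

definition atom_prod :: "(nat \<Rightarrow> real) \<Rightarrow> nat \<Rightarrow> nat set \<Rightarrow> real" where
  "atom_prod a n J = (\<Prod>j\<in>J. a j) * (\<Prod>j\<in>{1..n} - J. 1 - a j)"

definition k_wise_indep :: "'a measure \<Rightarrow> (nat \<Rightarrow> 'a set) \<Rightarrow> nat set \<Rightarrow> nat \<Rightarrow> bool" where
  "k_wise_indep M A I k \<longleftrightarrow>
     (\<forall>J. J \<subseteq> I \<and> finite J \<and> card J = k \<longrightarrow> prob_space.indep_events M A J)"

end

theory Submission
  imports Defs
begin

text \<open>
  If \<open>j \<notin> J\<close>, the atoms of \<open>J\<close> and \<open>insert j J\<close> together form an intersection of the other
  \<open>n - 1\<close> events or their complements, so \<open>(n - 1)\<close>-wise independence determines the sum of their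
  probabilities. Hence the deviation of the atom probability from its value under full
  independence changes sign whenever an index is added, which gives the form \<open>(- 1) ^ card J * s\<close>.
  The bounds on \<open>s\<close> are the nonnegativity of the atoms of \<open>{1..2 * m}\<close> and \<open>{1..2 * p + 1}\<close>.
\<close>

text \<open>Independence of events passes to the sigma-algebras they generate, and each of these
  contains the complement as well. \<open>K\<close> must be nonempty because the empty intersection
  is \<open>UNIV\<close> rather than \<open>space M\<close>.\<close>

lemma (in prob_space) prob_Int_indep_events_compl:
  assumes indep: "indep_events A K" and K: "finite K" "K \<noteq> {}"
  shows "prob (\<Inter>i\<in>K. if i \<in> J then A i else space M - A i) =
    (\<Prod>i\<in>K. if i \<in> J then prob (A i) else 1 - prob (A i))"
proof -
  have ev: "A i \<in> events" if "i \<in> K" for i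
    using indep that by (auto simp: indep_events_def)
  have "indep_sets (\<lambda>i. sigma_sets (space M) {A i}) K"
    using indep unfolding indep_events_def_alt
    \<comment> \<open>A singleton generator \<open>{A i}\<close> is trivially closed under
      intersection, as the extension to generated sigma-algebras requires.\<close>
    by (intro indep_sets_sigma) (auto simp: Int_stable_def)
  moreover have "(if i \<in> J then A i else space M - A i) \<in> sigma_sets (space M) {A i}" for i
    by (auto intro: sigma_sets.intros)
  ultimately have "prob (\<Inter>i\<in>K. if i \<in> J then A i else space M - A i) =
      (\<Prod>i\<in>K. prob (if i \<in> J then A i else space M - A i))"
    using K by (intro indep_setsD[where I = K]) (blast | assumption)+
  also have "\<dots> = (\<Prod>i\<in>K. if i \<in> J then prob (A i) else 1 - prob (A i))"
    using ev by (intro prod.cong) (auto simp: prob_compl)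
  finally show ?thesis .
qed

text \<open>The two products differ only in the factor at \<open>j\<close>, which is
  \<open>1 - a j\<close> in one and \<open>a j\<close> in the other; these factors sum to 1.\<close>

lemma atom_prod_insert:
  assumes "J \<subseteq> {1..n}" "j \<in> {1..n}" "j \<notin> J"
  shows "atom_prod a n J + atom_prod a n (insert j J) =
    (\<Prod>i\<in>{1..n} - {j}. if i \<in> J then a i else 1 - a i)"
proof -
  have fin: "finite J"
    using assms(1) finite_subset by blast
  have co: "(\<Prod>i\<in>{1..n} - J. 1 - a i) =
      (1 - a j) * (\<Prod>i\<in>{1..n} - insert j J. 1 - a i)"
    using assms prod.remove[of "{1..n} - J" j "\<lambda>i. 1 - a i"]
    by (simp flip: Diff_insert)
  have "{1..n} - {j} = J \<union> ({1..n} - insert j J)"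
    using assms by auto
  then have "(\<Prod>i\<in>{1..n} - {j}. if i \<in> J then a i else 1 - a i) =
      (\<Prod>i\<in>J. if i \<in> J then a i else 1 - a i) *
      (\<Prod>i\<in>{1..n} - insert j J. if i \<in> J then a i else 1 - a i)"
    using fin by (simp only:) (intro prod.union_disjoint; auto)
  also have "\<dots> = (\<Prod>i\<in>J. a i) * (\<Prod>i\<in>{1..n} - insert j J. 1 - a i)"
    by (intro arg_cong2[where f = "(*)"] prod.cong) auto
  finally show ?thesis
    unfolding atom_prod_def co using assms(3) fin by (simp add: algebra_simps)
qed

lemma atom_event_eq:
  assumes "J \<subseteq> {1..n}"
  shows "atom_event \<Omega> A n J = {x \<in> \<Omega>. \<forall>i\<in>{1..n}. x \<in> A i \<longleftrightarrow> i \<in> J}"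
  unfolding atom_event_def using assms by blast

lemma (in prob_space) prob_atom_event_insert:
  assumes n: "n \<ge> 2" and ev: "\<And>i. i \<in> {1..n} \<Longrightarrow> A i \<in> events"
    and indep: "k_wise_indep M A {1..n} (n - 1)"
    and J: "J \<subseteq> {1..n}" "j \<in> {1..n}" "j \<notin> J"
  shows "prob (atom_event (space M) A n J) + prob (atom_event (space M) A n (insert j J)) =
    atom_prod (\<lambda>i. prob (A i)) n J + atom_prod (\<lambda>i. prob (A i)) n (insert j J)"
proof -
  let ?K = "{1..n} - {j}"
  have card: "card ?K = n - 1"
    using J by simp
  \<comment> \<open>Here \<open>n \<ge> 2\<close> enters: removing \<open>j\<close> leaves at least
    one index.\<close>
  with n have "card ?K \<noteq> 0"
    by linarith
  then have ne: "?K \<noteq> {}"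
    by (metis card.empty)
  have ind: "indep_events A ?K"
    using indep[unfolded k_wise_indep_def, rule_format, of ?K] card by auto
  have at: "atom_event (space M) A n L \<in> events" if "L \<subseteq> {1..n}" for L
  proof -
    have "{x \<in> space M. x \<in> A i \<longleftrightarrow> i \<in> L} \<in> events" if "i \<in> {1..n}" for i
    proof -
      have "{x \<in> space M. x \<in> A i \<longleftrightarrow> i \<in> L} =
          (if i \<in> L then space M \<inter> A i else space M - A i)"
        by auto
      then show ?thesis
        using ev[OF that] by auto
    qed
    then show ?thesis
      unfolding atom_event_eq[OF that] by (intro sets.sets_Collect_finite_All) auto
  qed
  \<comment> \<open>Since \<open>?K\<close> is nonempty, some factor confines \<open>x\<close> to
    \<open>space M\<close>.\<close>
  have "x \<in> (\<Inter>i\<in>?K. if i \<in> J then A i else space M - A i) \<longleftrightarrow>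
      x \<in> space M \<and> (\<forall>i\<in>?K. x \<in> A i \<longleftrightarrow> i \<in> J)" for x
  proof -
    have "x \<in> (if i \<in> J then A i else space M - A i) \<longleftrightarrow>
        x \<in> space M \<and> (x \<in> A i \<longleftrightarrow> i \<in> J)" if "i \<in> ?K" for i
      using sets.sets_into_space[OF ev, of i] that by auto
    with ne show ?thesis
      by (simp only: INT_iff) blast
  qed
  moreover have "x \<in> atom_event (space M) A n J \<union> atom_event (space M) A n (insert j J) \<longleftrightarrow>
      x \<in> space M \<and> (\<forall>i\<in>?K. x \<in> A i \<longleftrightarrow> i \<in> J)" for x
  proof -
    have insert: "insert j J \<subseteq> {1..n}"
      using J by blast
    show ?thesis
      unfolding Un_iff atom_event_eq[OF J(1)] atom_event_eq[OF insert] mem_Collect_eq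
      using J by blast
  qed
  ultimately have Int: "(\<Inter>i\<in>?K. if i \<in> J then A i else space M - A i) =
      atom_event (space M) A n J \<union> atom_event (space M) A n (insert j J)"
    by blast
  \<comment> \<open>Membership in \<open>A j\<close> separates the two atoms, so their probabilities
    add.\<close>
  have "atom_event (space M) A n J \<inter> atom_event (space M) A n (insert j J) = {}"
    using J by (auto simp: atom_event_def)
  then have "prob (atom_event (space M) A n J) + prob (atom_event (space M) A n (insert j J)) =
      prob (\<Inter>i\<in>?K. if i \<in> J then A i else space M - A i)"
    unfolding Int using J by (intro finite_measure_Union[symmetric] at) auto
  also have "\<dots> = (\<Prod>i\<in>?K. if i \<in> J then prob (A i) else 1 - prob (A i))"
    using ind ne by (intro prob_Int_indep_events_compl) auto
  finally show ?thesis
    by (simp add: atom_prod_insert[OF J])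
qed

lemma (in prob_space) prob_atom_event_eq:
  assumes n: "n \<ge> 2" and ev: "\<And>i. i \<in> {1..n} \<Longrightarrow> A i \<in> events"
    and indep: "k_wise_indep M A {1..n} (n - 1)"
    and J: "J \<subseteq> {1..n}"
  shows "prob (atom_event (space M) A n J) = atom_prod (\<lambda>i. prob (A i)) n J +
    (- 1) ^ card J * (prob (atom_event (space M) A n {}) - atom_prod (\<lambda>i. prob (A i)) n {})"
proof -
  have "finite J"
    using J finite_subset by blast
  then show ?thesis
    using J
  proof (induction rule: finite_induct)
    case empty
    then show ?case by simp
  next
    case (insert j J)
    then show ?case
      using prob_atom_event_insert[OF n ev indep, of J j] by simp
  qed
qed

lemma atom_prod_atLeastAtMost:
  assumes "k \<le> n"
  shows "atom_prod a n {1..k} = (\<Prod>i\<in>{1..k}. a i) * (\<Prod>i\<in>{k + 1..n}. 1 - a i)"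
proof -
  have "{1..n} - {1..k} = {k + 1..n}"
    by auto
  then show ?thesis
    by (simp add: atom_prod_def)
qed

text \<open>The assumption \<open>P 0\<close> keeps the set nonempty, so \<open>Max\<close> is a
  genuine maximum. For \<open>p\<close> and \<open>m\<close> it holds vacuously, as
  \<open>{1..0}\<close> is empty.\<close>

lemma Max_Collect_atMost_le:
  fixes b :: nat
  assumes "P 0"
  shows "Max {q \<in> {0..b}. P q} \<le> b"
  using assms by (subst Max_le_iff) auto

theorem theorem9:
  fixes n p m :: nat
    and a :: "nat \<Rightarrow> real"
    and \<omega> :: "nat set \<Rightarrow> 'a"
    and \<Omega> :: "'a set"
    and A :: "nat \<Rightarrow> 'a set"
    and P :: "'a measure"
  assumes n: "n \<ge> 2"
    and a: "0 \<le> a 1" "mono_on {1..n} a" "a n \<le> 1"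
    and p: "p = Max {q \<in> {0..(n - 1) div 2}. \<forall>i\<in>{1..q}. a (2 * i) + a (2 * i + 1) \<le> 1}"
    and m: "m = Max {q \<in> {0..n div 2}. \<forall>i\<in>{1..q}. a (2 * i - 1) + a (2 * i) \<le> 1}"
    and \<omega>: "inj_on \<omega> (Pow {1..n})"
    and \<Omega>: "\<Omega> = sample_space \<omega> n"
    and A: "A = gen_event \<omega> n"
    and P: "prob_space P" "space P = \<Omega>" "sets P = Pow \<Omega>"
    and marginals: "\<forall>j\<in>{1..n}. measure P (A j) = a j"
    and indep: "k_wise_indep P A {1..n} (n - 1)"
  shows "\<exists>s::real.
    (\<forall>J. J \<subseteq> {1..n} \<longrightarrow>
       measure P (atom_event \<Omega> A n J) = atom_prod a n J + (- 1) ^ card J * s) \<and>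
    - ((\<Prod>i\<in>{1..2 * m}. a i) * (\<Prod>i\<in>{2 * m + 1..n}. 1 - a i)) \<le> s \<and>
    s \<le> (\<Prod>i\<in>{1..2 * p + 1}. a i) * (\<Prod>i\<in>{2 * p + 2..n}. 1 - a i)"
proof -
  interpret prob_space P by (rule P(1))
  have ev: "A i \<in> events" for i
    unfolding P(3) \<Omega> A by (auto simp: gen_event_def sample_space_def)
  have prod_eq: "atom_prod (\<lambda>i. prob (A i)) n J = atom_prod a n J" if "J \<subseteq> {1..n}" for J
    using marginals that unfolding atom_prod_def
    by (intro arg_cong2[where f = "(*)"] prod.cong) auto
  \<comment> \<open>The parameter is the deviation at the empty index set, where the sign is
    positive.\<close>
  define s where "s = prob (atom_event \<Omega> A n {}) - atom_prod a n {}"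
  have main: "prob (atom_event \<Omega> A n J) = atom_prod a n J + (- 1) ^ card J * s"
    if "J \<subseteq> {1..n}" for J
    using prob_atom_event_eq[OF n ev indep that] P prod_eq that by (simp add: s_def)
  have "p \<le> (n - 1) div 2"
    unfolding p by (rule Max_Collect_atMost_le) simp
  with n have p_le: "2 * p + 1 \<le> n"
    by linarith
  have "m \<le> n div 2"
    unfolding m by (rule Max_Collect_atMost_le) simp
  then have m_le: "2 * m \<le> n"
    by linarith
  \<comment> \<open>An initial segment of even length carries the sign \<open>+\<close>, hence
    bounds \<open>s\<close> from below.\<close>
  have "0 \<le> atom_prod a n {1..2 * m} + s"
    using main[of "{1..2 * m}"] m_le
      measure_nonneg[of P "atom_event \<Omega> A n {1..2 * m}"] by simp
  then have lower: "- ((\<Prod>i\<in>{1..2 * m}. a i) * (\<Prod>i\<in>{2 * m + 1..n}. 1 - a i)) \<le> s"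
    using atom_prod_atLeastAtMost[OF m_le, of a] by simp
  \<comment> \<open>Odd length flips the sign, so nonnegativity now bounds \<open>s\<close> from
    above.\<close>
  have "0 \<le> atom_prod a n {1..2 * p + 1} - s"
    using main[of "{1..2 * p + 1}"] p_le
      measure_nonneg[of P "atom_event \<Omega> A n {1..2 * p + 1}"] by simp
  then have upper: "s \<le> (\<Prod>i\<in>{1..2 * p + 1}. a i) * (\<Prod>i\<in>{2 * p + 2..n}. 1 - a i)"
    using atom_prod_atLeastAtMost[OF p_le, of a] by simp
  show ?thesis
    using main lower upper by blast
qed

end
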